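(* Let $S\subseteq\mathbb{N}^d$ be an affine semigroup which is a gluing $S=S_1+_\delta S_2$ of $S_1$ and $S_2$ by $\delta$, where $S_1$ and $S_2$ are MPD-semigroups. Then $S$ is an MPD-semigroup and $$\mathrm{PF}(S)=\{f+g+\delta \mid f\in \mathrm{PF}(S_1),\ g\in \mathrm{PF}(S_2)\}.$$
   Context: $\mathbb{N}$ denotes the non-negative integers. An affine semigroup $S$ is a finitely generated submonoid of $\mathbb{N}^d$; it has a unique minimal generating set $\{a_1,\dots,a_n\}$. Put $\mathrm{cone}(S)=\{\sum_{i=1}^n\lambda_i a_i\mid \lambda_i\in\mathbb{Q}_{\ge 0}\}$ and $\mathcal{H}(S)=(\mathrm{cone}(S)\setminus S)\cap\mathbb{N}^d$. The set of pseudo-Frobenius elements of $S$ is $\mathrm{PF}(S)=\{f\in\mathcal{H}(S)\mid f+s\in S \text{ for all } s\in S\setminus\{0\}\}=\{f\in\mathcal{H}(S)\mid f+a_j\in S \text{ for all } j\}$. $S$ is called an MPD-semigroup (maximal projective dimension) if $\mathrm{PF}(S)\neq\emptyset$ (for $n\ge 2$ this is equivalent to the semigroup ring $k[S]$ having projective dimension $n-1$ over $k[x_1,\dots,x_n]$, where $k$ is a field and $x_i\mapsto \mathbf{t}^{a_i}$). Gluing: let $G(T)=\{a-b\mid a,b\in T\}\subseteq\mathbb{Z}^d$ be the group spanned by $T$. Let $A$ be the minimal generating set of $S$, $A=A_1\amalg A_2$ a nontrivial partition (both parts nonempty), and $S_i$ the submonoid of $\mathbb{N}^d$ generated by $A_i$,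 $i=1,2$, so that $S=S_1+S_2$. Then $S$ is the gluing of $S_1$ and $S_2$ by $\delta$, written $S=S_1+_\delta S_2$, if $\delta\in S_1\cap S_2$ and $G(S_1)\cap G(S_2)=\delta\mathbb{Z}$.
   Formalization: The formal theorem assumes δ ≠ 0; for δ = 0 the claim is false, e.g. S1 = ⟨(2,0),(3,0)⟩, S2 = ⟨(0,2),(0,3)⟩, where (1,0)+(0,1) = (1,1) is not in PF(S) since (3,1) is not in S. *)

theory Defs
  imports Complex_Main "HOL-Analysis.Finite_Cartesian_Product"
begin

text \<open>The ambient monoid of d-tuples of non-negative integers is \<open>nat ^ 'd\<close>, with d the
  cardinality of the finite index type \<open>'d\<close>.  The group spanned by a semigroup lives
  in \<open>int ^ 'd\<close> and its cone in \<open>rat ^ 'd\<close>; \<open>of_nat_vec\<close> is the inclusion into both.\<close>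

definition of_nat_vec :: "nat ^ 'd \<Rightarrow> ('a::semiring_1) ^ 'd" where
  "of_nat_vec x = (\<chi> i. of_nat (x $ i))"

definition is_submonoid :: "'a::comm_monoid_add set \<Rightarrow> bool" where
  "is_submonoid M \<longleftrightarrow> 0 \<in> M \<and> (\<forall>x\<in>M. \<forall>y\<in>M. x + y \<in> M)"

definition submonoid_generated :: "'a::comm_monoid_add set \<Rightarrow> 'a set" where
  "submonoid_generated A = is_submonoid hull A"

definition affine_semigroup :: "(nat ^ 'd) set \<Rightarrow> bool" where
  "affine_semigroup S \<longleftrightarrow> (\<exists>A. finite A \<and> S = submonoid_generated A)"

definition is_minimal_generating_set :: "'a::comm_monoid_add set \<Rightarrow> 'a set \<Rightarrow> bool" where
  "is_minimal_generating_set A S \<longleftrightarrow>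
     submonoid_generated A = S \<and> (\<forall>B. B \<subset> A \<longrightarrow> submonoid_generated B \<noteq> S)"

text \<open>Well defined for affine semigroups by \<open>ex1_minimal_generating_set\<close> below.\<close>

definition min_gens :: "(nat ^ 'd) set \<Rightarrow> (nat ^ 'd) set" where
  "min_gens S = (THE A. is_minimal_generating_set A S)"

definition semigroup_cone :: "(nat ^ 'd) set \<Rightarrow> (rat ^ 'd) set" where
  "semigroup_cone S =
     {(\<Sum>a\<in>min_gens S. c a *s of_nat_vec a) | c. \<forall>a\<in>min_gens S. 0 \<le> c a}"

definition gaps :: "(nat ^ 'd) set \<Rightarrow> (nat ^ 'd) set" where
  "gaps S = {x. of_nat_vec x \<in> semigroup_cone S \<and> x \<notin> S}"

definition PF :: "(nat ^ 'd) set \<Rightarrow> (nat ^ 'd) set" where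
  "PF S = {f \<in> gaps S. \<forall>s\<in>S - {0}. f + s \<in> S}"

definition MPD_semigroup :: "(nat ^ 'd) set \<Rightarrow> bool" where
  "MPD_semigroup S \<longleftrightarrow> affine_semigroup S \<and> PF S \<noteq> {}"

definition spanned_group :: "(nat ^ 'd) set \<Rightarrow> (int ^ 'd) set" where
  "spanned_group T = {of_nat_vec a - of_nat_vec b | a b. a \<in> T \<and> b \<in> T}"

text \<open>As stated, \<open>is_gluing\<close> admits \<open>\<delta> = 0\<close>, when S is the direct sum of S1 and S2; for results on
  gluings in the usual sense \<open>\<delta> \<noteq> 0\<close> has to be assumed in addition.\<close>

definition is_gluing ::
    "(nat ^ 'd) set \<Rightarrow> (nat ^ 'd) set \<Rightarrow> (nat ^ 'd) set \<Rightarrow> nat ^ 'd \<Rightarrow> bool" where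
  "is_gluing S S1 S2 \<delta> \<longleftrightarrow>
     (\<exists>A1 A2. A1 \<noteq> {} \<and> A2 \<noteq> {} \<and> A1 \<inter> A2 = {} \<and> A1 \<union> A2 = min_gens S \<and>
        S1 = submonoid_generated A1 \<and> S2 = submonoid_generated A2) \<and>
     \<delta> \<in> S1 \<inter> S2 \<and>
     spanned_group S1 \<inter> spanned_group S2 = {k *s of_nat_vec \<delta> | k. True}"


lemma is_submonoid_generated: "is_submonoid (submonoid_generated A)"
  unfolding submonoid_generated_def
  by (rule hull_in) (auto simp: is_submonoid_def)

lemma submonoid_generated_superset: "A \<subseteq> submonoid_generated A"
  unfolding submonoid_generated_def by (rule hull_subset)

lemma submonoid_generated_minimal:
  "A \<subseteq> M \<Longrightarrow> is_submonoid M \<Longrightarrow> submonoid_generated A \<subseteq> M"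
  unfolding submonoid_generated_def by (rule hull_minimal)

lemma ex1_minimal_generating_set:
  fixes S :: "(nat ^ 'd) set"
  assumes "is_submonoid S"
  shows "\<exists>!A. is_minimal_generating_set A S"
proof -
  define At where "At = {x \<in> S - {0}. \<forall>u\<in>S. \<forall>v\<in>S. x = u + v \<longrightarrow> u = 0 \<or> v = 0}"
  define w :: "nat ^ 'd \<Rightarrow> nat" where "w x = (\<Sum>i\<in>UNIV. x $ i)" for x
  have w_add: "w (x + y) = w x + w y" for x y
    by (simp add: w_def sum.distrib)
  have w_pos: "w x > 0" if "x \<noteq> 0" for x
    using that by (auto simp: w_def vec_eq_iff intro!: Nat.gr0I)
  have S0: "0 \<in> S" and Sadd: "\<And>x y. x \<in> S \<Longrightarrow> y \<in> S \<Longrightarrow> x + y \<in> S"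
    using assms by (auto simp: is_submonoid_def)
  have gen: "x \<in> submonoid_generated At" if "x \<in> S" for x
    using that
  proof (induction "w x" arbitrary: x rule: less_induct)
    case less
    show ?case
    proof (cases "x = 0 \<or> x \<in> At")
      case True
      then show ?thesis
        using is_submonoid_generated[of At] submonoid_generated_superset[of At]
        by (auto simp: is_submonoid_def)
    next
      case False
      then obtain u v where uv: "u \<in> S" "v \<in> S" "x = u + v" "u \<noteq> 0" "v \<noteq> 0"
        using less.prems by (auto simp: At_def)
      have "w u < w x" "w v < w x"
        using uv w_pos[of u] w_pos[of v] w_add[of u v] by auto
      then have "u \<in> submonoid_generated At" "v \<in> submonoid_generated At"
        using less.hyps uv by auto
      then show ?thesis
        using is_submonoid_generated[of At] uv by (auto simp: is_submonoid_def)
    qed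
  qed
  have At_gen: "submonoid_generated At = S"
  proof
    show "submonoid_generated At \<subseteq> S"
      by (rule submonoid_generated_minimal) (auto simp: At_def assms)
  qed (use gen in auto)
  have sub: "At \<subseteq> B" if B: "submonoid_generated B = S" for B
  proof (rule ccontr)
    assume "\<not> At \<subseteq> B"
    then obtain x where x: "x \<in> At" "x \<notin> B" by auto
    have BS: "B \<subseteq> S" using submonoid_generated_superset[of B] B by simp
    have "is_submonoid (S - {x})"
      unfolding is_submonoid_def
    proof (intro conjI ballI)
      show "0 \<in> S - {x}" using x S0 by (auto simp: At_def)
    next
      fix y z assume yz: "y \<in> S - {x}" "z \<in> S - {x}"
      then have "y + z \<noteq> x" using x by (auto simp: At_def)
      then show "y + z \<in> S - {x}" using yz Sadd by auto
    qed
    then have "submonoid_generated B \<subseteq> S - {x}"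
      using BS x by (intro submonoid_generated_minimal) auto
    then show False using B x by (auto simp: At_def)
  qed
  show ?thesis
  proof (rule ex1I[of _ At])
    show "is_minimal_generating_set At S"
      using At_gen sub by (auto simp: is_minimal_generating_set_def)
  next
    fix A assume "is_minimal_generating_set A S"
    then show "A = At"
      using At_gen sub[of A] by (auto simp: is_minimal_generating_set_def psubset_eq)
  qed
qed

end

theory Submission
  imports Defs
begin

text \<open>
  Work in the group of integer vectors.  By the gluing condition, two decompositions of the same
  vector along \<open>G(S\<^sub>1) + G(S\<^sub>2)\<close> differ by a multiple of \<open>\<delta>\<close>.  This shows that \<open>f + g + \<delta>\<close>
  lies outside \<open>S\<close>.  Conversely, for \<open>h\<close> in \<open>PF(S)\<close> write \<open>h + \<delta> = s\<^sub>1 + s\<^sub>2\<close> with \<open>s\<^sub>1\<close> of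
  least weight; then \<open>s\<^sub>1 - \<delta>\<close> and \<open>s\<^sub>2 - \<delta>\<close> lie outside \<open>S\<^sub>1\<close> and \<open>S\<^sub>2\<close> and send nonzero elements
  of these semigroups into them.  That they also lie in the cones is a pigeonhole argument on
  the finitely many generators.
\<close>

section \<open>Submonoids and pseudo-Frobenius vectors over the integers\<close>

lemma submonoid_add: "is_submonoid T \<Longrightarrow> x \<in> T \<Longrightarrow> y \<in> T \<Longrightarrow> x + y \<in> T"
  by (simp add: is_submonoid_def)

lemma submonoid_zero: "is_submonoid T \<Longrightarrow> 0 \<in> T"
  by (simp add: is_submonoid_def)

lemma submonoid_of_nat_scale:
  fixes x :: "'a::semiring_1 ^ 'd"
  assumes "is_submonoid T" "x \<in> T"
  shows "of_nat n *s x \<in> T"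
  by (induction n) (auto simp: assms submonoid_zero vector_sadd_rdistrib intro!: submonoid_add)

lemma submonoid_sum:
  assumes "is_submonoid T" "\<And>a. a \<in> A \<Longrightarrow> g a \<in> T"
  shows "sum g A \<in> T"
  using assms(2)
  by (induction A rule: infinite_finite_induct)
    (auto simp: assms(1) submonoid_zero intro: submonoid_add)

text \<open>Counterpart of \<open>PF\<close> inside the integer vectors, where differences exist.
  The clause on a positive multiple stands for membership in the rational cone;
  \<open>in_semigroup_cone_iff\<close> justifies this and \<open>of_nat_vec_image_PF\<close>
  identifies the two notions.\<close>

definition pseudo_frobenius :: "(int ^ 'd) set \<Rightarrow> (int ^ 'd) set" where
  "pseudo_frobenius T =
     {f. f \<notin> T \<and> (\<exists>n::nat. n > 0 \<and> of_nat n *s f \<in> T) \<and> (\<forall>s\<in>T - {0}. f + s \<in> T)}"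

lemma nonneg_multiple_in_submonoid:
  assumes "is_submonoid T" "x \<in> T" "0 \<le> (k::int)"
  shows "k *s x \<in> T"
  using submonoid_of_nat_scale[OF assms(1,2), of "nat k"] assms(3) by simp

lemma neg_notin_nonneg_submonoid:
  fixes T :: "(int ^ 'd) set"
  assumes nonneg: "\<And>x i. x \<in> T \<Longrightarrow> 0 \<le> x $ i"
    and "a \<in> T" "a \<noteq> 0" "(n::nat) > 0"
  shows "of_nat n *s (- a) \<notin> T"
proof
  assume "of_nat n *s (- a) \<in> T"
  then have *: "0 \<le> int n * - (a $ i)" for i
    using nonneg[of _ i] by fastforce
  have "a $ i = 0" for i
    using *[of i] nonneg[OF \<open>a \<in> T\<close>, of i] \<open>n > 0\<close> by (simp add: mult_le_0_iff)
  then show False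
    using \<open>a \<noteq> 0\<close> by (simp add: vec_eq_iff)
qed

text \<open>Pigeonhole: as \<open>f + a\<close> is a nonzero element of \<open>T\<close>, some
  generator \<open>\<phi> a\<close> can be subtracted from it. The map \<open>\<phi>\<close> on the
  finite set \<open>A\<close> runs into a cycle, and summing the relations around the cycle cancels
  the generators and leaves a multiple of \<open>f\<close>.\<close>

lemma some_multiple_in_submonoid:
  fixes T :: "(int ^ 'd) set"
  assumes T: "is_submonoid T" and A: "finite A" "A \<subseteq> T - {0}"
    and gen: "\<And>x. x \<in> T - {0} \<Longrightarrow> \<exists>b\<in>A. x - b \<in> T"
    and f: "\<And>a. a \<in> T - {0} \<Longrightarrow> f + a \<in> T - {0}"
    and "T \<noteq> {0}"
  shows "\<exists>n::nat. n > 0 \<and> of_nat n *s f \<in> T"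
proof -
  have "\<forall>a\<in>A. \<exists>b\<in>A. f + a - b \<in> T"
    using gen f A(2) by blast
  then obtain \<phi> where \<phi>: "\<And>a. a \<in> A \<Longrightarrow> \<phi> a \<in> A" "\<And>a. a \<in> A \<Longrightarrow> f + a - \<phi> a \<in> T"
    by metis
  \<comment> \<open>The relations along the orbit of \<open>a\<close> telescope: each step
    contributes one \<open>f\<close> and replaces the current generator by its image.\<close>
  have iter: "(\<phi> ^^ n) a \<in> A" "of_nat n *s f + a - (\<phi> ^^ n) a \<in> T" if "a \<in> A" for n a
  proof (induction n)
    case 0
    { case 1 show ?case using that by simp }
    { case 2 show ?case using T by (simp add: submonoid_zero) }
  next
    case (Suc n)
    { case 1 show ?case using Suc \<phi> by simp }
    { case 2
      have "(of_nat n *s f + a - (\<phi> ^^ n) a) + (f + (\<phi> ^^ n) a - \<phi> ((\<phi> ^^ n) a)) \<in> T"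
        using Suc \<phi> by (intro submonoid_add T) auto
      then show ?case
        by (simp add: vector_sadd_rdistrib algebra_simps) }
  qed
  obtain a where a: "a \<in> A"
    using gen \<open>T \<noteq> {0}\<close> submonoid_zero[OF T] by blast
  have "range (\<lambda>n. (\<phi> ^^ n) a) \<subseteq> A"
    using iter(1)[OF a] by auto
  then have "\<not> inj (\<lambda>n. (\<phi> ^^ n) a)"
    using A(1) finite_subset finite_imageD infinite_UNIV_nat by blast
  then obtain i j where ij: "i < j" "(\<phi> ^^ i) a = (\<phi> ^^ j) a"
    using linorder_injI[of "\<lambda>n. (\<phi> ^^ n) a"] by blast
  \<comment> \<open>Since \<open>c\<close> lies on the cycle, restarting \<open>iter\<close> at
    \<open>c\<close> for one period makes the two generator terms equal.\<close>
  define c where "c = (\<phi> ^^ i) a"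
  have "(\<phi> ^^ (j - i)) c = (\<phi> ^^ (j - i + i)) a"
    by (simp add: c_def funpow_add)
  then have "(\<phi> ^^ (j - i)) c = c"
    using ij by (simp add: c_def)
  then have "of_nat (j - i) *s f \<in> T"
    using iter(2)[of c "j - i"] iter(1)[OF a, of i] by (simp add: c_def[symmetric])
  then show ?thesis
    using ij(1) by (intro exI[of _ "j - i"]) auto
qed

text \<open>The pigeonhole lemma supplies the cone condition as long as \<open>f + a\<close> never
  vanishes. In \<nat> the vector -1 has the absorbing property without lying in the cone; the
  assumption that \<open>T\<close> has some pseudo-Frobenius element \<open>g\<close> excludes such
  cases.\<close>

lemma pseudo_frobeniusI:
  fixes T :: "(int ^ 'd) set"
  assumes T: "is_submonoid T" and nonneg: "\<And>x i. x \<in> T \<Longrightarrow> 0 \<le> x $ i"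
    and A: "finite A" "A \<subseteq> T - {0}"
    and gen: "\<And>x. x \<in> T - {0} \<Longrightarrow> \<exists>b\<in>A. x - b \<in> T"
    and ne: "T \<noteq> {0}" "pseudo_frobenius T \<noteq> {}"
    and f: "f \<notin> T" "\<And>a. a \<in> T - {0} \<Longrightarrow> f + a \<in> T"
  shows "f \<in> pseudo_frobenius T"
proof -
  obtain g where g: "g \<notin> T" "\<exists>n::nat. n > 0 \<and> of_nat n *s g \<in> T" "\<forall>s\<in>T - {0}. g + s \<in> T"
    using ne(2) by (auto simp: pseudo_frobenius_def)
  have "f + a \<noteq> 0" if a: "a \<in> T - {0}" for a
  proof
    assume "f + a = 0"
    then have fa: "f = - a" by (simp add: eq_neg_iff_add_eq_0)
    show False
    \<comment> \<open>With \<open>f = - a\<close>, either \<open>g = - a\<close>, which has no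
      positive multiple among nonnegative vectors, or \<open>g + a\<close> is a nonzero element of
      \<open>T\<close> that \<open>f\<close> sends to \<open>g\<close>, forcing \<open>g\<close>
      into \<open>T\<close>.\<close>
    proof (cases "g + a = 0")
      case True
      then have "g = - a" by (simp add: eq_neg_iff_add_eq_0)
      then show False
        using g(2) neg_notin_nonneg_submonoid[of T a] nonneg a by auto
    next
      case False
      then have "f + (g + a) \<in> T" using g(3) a f(2) by blast
      then show False using g(1) fa by simp
    qed
  qed
  then show ?thesis
    using some_multiple_in_submonoid[OF T A gen _ ne(1), of f] f
    by (auto simp: pseudo_frobenius_def)
qed

section \<open>The gluing formula for integer vectors\<close>

text \<open>An equality would give \<open>f = t1 + (k - 1) *s \<delta>\<close> and
  \<open>g = t2 - k *s \<delta>\<close> for an integer \<open>k\<close>. One of \<open>k - 1\<close>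
  and \<open>- k\<close> is nonnegative, so \<open>f\<close> or \<open>g\<close> would lie in its
  submonoid.\<close>

lemma gap_sum_notin:
  fixes T1 T2 :: "(int ^ 'd) set"
  assumes "is_submonoid T1" "is_submonoid T2" "\<delta> \<in> T1" "\<delta> \<in> T2"
    and glue: "\<And>a b c d. \<lbrakk>a \<in> T1; b \<in> T1; c \<in> T2; d \<in> T2; a - b = c - d\<rbrakk> \<Longrightarrow> \<exists>k. a - b = k *s \<delta>"
    and "f + \<delta> \<in> T1" "g + \<delta> \<in> T2" "f \<notin> T1" "g \<notin> T2"
    and t: "t1 \<in> T1" "t2 \<in> T2"
  shows "f + g + \<delta> \<noteq> t1 + t2"
proof
  assume eq: "f + g + \<delta> = t1 + t2"
  \<comment> \<open>Only \<open>f + \<delta>\<close> and \<open>g + \<delta>\<close> are known to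
    lie in the submonoids, so \<delta> is added and subtracted on the right to obtain differences to
    which \<open>glue\<close> applies.\<close>
  then have eq': "(f + \<delta>) - t1 = (t2 + \<delta>) - (g + \<delta>)"
    by (simp add: algebra_simps)
  obtain k where k: "(f + \<delta>) - t1 = k *s \<delta>"
    using glue[OF _ _ _ _ eq'] assms by (blast intro: submonoid_add)
  have f: "f = t1 + (k - 1) *s \<delta>"
    using k by (simp add: vec_eq_iff algebra_simps)
  have g: "g = t2 + (- k) *s \<delta>"
    using k eq' by (simp add: vec_eq_iff algebra_simps)
  show False
  proof (cases "k \<ge> 1")
    case True
    then have "f \<in> T1"
      unfolding f using assms by (intro submonoid_add nonneg_multiple_in_submonoid) auto
    then show False using assms by simp
  next
    case False
    then have "g \<in> T2"
      unfolding g using assms by (intro submonoid_add nonneg_multiple_in_submonoid) auto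
    then show False using assms by simp
  qed
qed

lemma pseudo_frobenius_gluing:
  fixes T1 T2 :: "(int ^ 'd) set"
  assumes T1: "is_submonoid T1" "\<And>x i. x \<in> T1 \<Longrightarrow> 0 \<le> x $ i"
    and A1: "finite A1" "A1 \<subseteq> T1 - {0}" "\<And>x. x \<in> T1 - {0} \<Longrightarrow> \<exists>b\<in>A1. x - b \<in> T1"
    and T2: "is_submonoid T2" "\<And>x i. x \<in> T2 \<Longrightarrow> 0 \<le> x $ i"
    and A2: "finite A2" "A2 \<subseteq> T2 - {0}" "\<And>x. x \<in> T2 - {0} \<Longrightarrow> \<exists>b\<in>A2. x - b \<in> T2"
    and ne: "pseudo_frobenius T1 \<noteq> {}" "pseudo_frobenius T2 \<noteq> {}"
    and \<delta>: "\<delta> \<in> T1" "\<delta> \<in> T2" "\<delta> \<noteq> 0"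
    and glue: "\<And>a b c d. \<lbrakk>a \<in> T1; b \<in> T1; c \<in> T2; d \<in> T2; a - b = c - d\<rbrakk> \<Longrightarrow> \<exists>k. a - b = k *s \<delta>"
  shows "pseudo_frobenius {s1 + s2 | s1 s2. s1 \<in> T1 \<and> s2 \<in> T2} =
    {f + g + \<delta> | f g. f \<in> pseudo_frobenius T1 \<and> g \<in> pseudo_frobenius T2}"
    (is "pseudo_frobenius ?T = ?R")
proof
  have notin: "f + g + \<delta> \<notin> ?T"
    if "f + \<delta> \<in> T1" "g + \<delta> \<in> T2" "f \<notin> T1" "g \<notin> T2" for f g
    using gap_sum_notin[of T1 T2 \<delta> f g] T1(1) T2(1) \<delta>(1,2) glue that by blast
  show "?R \<subseteq> pseudo_frobenius ?T"
  proof
    fix h assume "h \<in> ?R"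
    then obtain f g where h: "h = f + g + \<delta>"
      and f: "f \<in> pseudo_frobenius T1" and g: "g \<in> pseudo_frobenius T2" by blast
    obtain m n where mn: "m > 0" "of_nat m *s f \<in> T1" "n > 0" "of_nat n *s g \<in> T2"
      using f g by (auto simp: pseudo_frobenius_def)
    have f': "f \<notin> T1" "\<And>s. s \<in> T1 \<Longrightarrow> s \<noteq> 0 \<Longrightarrow> f + s \<in> T1"
      and g': "g \<notin> T2" "\<And>s. s \<in> T2 \<Longrightarrow> s \<noteq> 0 \<Longrightarrow> g + s \<in> T2"
      using f g by (auto simp: pseudo_frobenius_def)
    have "h \<notin> ?T"
      unfolding h using notin[of f g] f' g' \<delta> by blast
    \<comment> \<open>The product \<open>m * n\<close> clears \<open>f\<close> and \<open>g\<close>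
      at once.\<close>
    moreover have "of_nat (m * n) *s h \<in> ?T"
    proof -
      have "of_nat (m * n) *s h =
          of_nat n *s (of_nat m *s f) + (of_nat m *s (of_nat n *s g) + of_nat (m * n) *s \<delta>)"
        by (simp add: h vec_eq_iff algebra_simps)
      moreover have "of_nat n *s (of_nat m *s f) \<in> T1"
        by (rule submonoid_of_nat_scale[OF T1(1) mn(2)])
      moreover have "of_nat m *s (of_nat n *s g) + of_nat (m * n) *s \<delta> \<in> T2"
        by (rule submonoid_add[OF T2(1) submonoid_of_nat_scale[OF T2(1) mn(4)]
              submonoid_of_nat_scale[OF T2(1) \<delta>(2)]])
      ultimately show ?thesis by blast
    qed
    moreover have "h + s \<in> ?T" if s: "s \<in> ?T - {0}" for s
    proof -
      obtain s1 s2 where s12: "s = s1 + s2" "s1 \<in> T1" "s2 \<in> T2" using s by blast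
      show ?thesis
      \<comment> \<open>A nonzero part of \<open>s\<close> is absorbed by one of \<open>f\<close>
        and \<open>g\<close>, and the spare \<delta> by the other.\<close>
      proof (cases "s1 = 0")
        case True
        then have "s2 \<noteq> 0" using s s12(1) by auto
        then have "f + \<delta> \<in> T1" "g + s2 \<in> T2" "h + s = (f + \<delta>) + (g + s2)"
          using f'(2)[OF \<delta>(1,3)] g'(2)[OF s12(3)] s12(1) True by (simp_all add: h)
        then show ?thesis by blast
      next
        case False
        then have "f + s1 \<in> T1" "(g + \<delta>) + s2 \<in> T2" "h + s = (f + s1) + ((g + \<delta>) + s2)"
          using f'(2)[OF s12(2)] submonoid_add[OF T2(1) g'(2)[OF \<delta>(2,3)] s12(3)] s12(1) False
          by (simp_all add: h)
        then show ?thesis by blast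
      qed
    qed
    ultimately show "h \<in> pseudo_frobenius ?T"
      using mn(1,3) unfolding pseudo_frobenius_def
      by (intro CollectI conjI exI[of _ "m * n"] ballI) simp_all
  qed
  show "pseudo_frobenius ?T \<subseteq> ?R"
  proof
    fix h assume h: "h \<in> pseudo_frobenius ?T"
    have inT: "s1 \<in> ?T" "s2 \<in> ?T" if "s1 \<in> T1" "s2 \<in> T2" for s1 s2
      using that submonoid_zero[OF T1(1)] submonoid_zero[OF T2(1)]
      by (force intro: exI[of _ 0])+
    have hT: "h \<notin> ?T" "\<And>s. s \<in> ?T \<Longrightarrow> s \<noteq> 0 \<Longrightarrow> h + s \<in> ?T"
      using h unfolding pseudo_frobenius_def by blast+
    \<comment> \<open>The coordinate sum is additive, nonnegative on \<open>T1\<close> and positive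
      at \<delta>, so subtracting \<delta> strictly lowers it.\<close>
    define w :: "int ^ 'd \<Rightarrow> int" where "w x = (\<Sum>i\<in>UNIV. x $ i)" for x
    have w_nonneg: "0 \<le> w x" if "x \<in> T1" for x
      using T1(2)[OF that] by (simp add: w_def sum_nonneg)
    have w_diff: "w (x - y) = w x - w y" for x y
      by (simp add: w_def sum_subtractf)
    have "w \<delta> \<noteq> 0"
      using \<delta>(3) T1(2)[OF \<delta>(1)] by (simp add: w_def sum_nonneg_eq_0_iff vec_eq_iff)
    then have w\<delta>: "w \<delta> > 0"
      using w_nonneg[OF \<delta>(1)] by simp
    \<comment> \<open>\<open>P s\<close> says that \<open>s\<close> is the \<open>T1\<close>-part of
      a decomposition of \<open>h + \<delta>\<close>; one exists because \<open>h\<close> absorbs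
      the nonzero element \<delta>.\<close>
    define P where "P s \<longleftrightarrow> s \<in> T1 \<and> h + \<delta> - s \<in> T2" for s
    have "h + \<delta> \<in> ?T"
      using hT(2) inT(1)[OF \<delta>(1,2)] \<delta>(3) by blast
    then obtain s1 s2 where s12: "s1 \<in> T1" "s2 \<in> T2" "h + \<delta> = s1 + s2"
      by blast
    then have "P s1"
      by (simp add: P_def)
    then obtain s where s: "P s" "\<And>x. P x \<Longrightarrow> nat (w s) \<le> nat (w x)"
      using ex_has_least_nat[of P s1 "\<lambda>x. nat (w x)"] by blast
    define f where "f = s - \<delta>"
    define g where "g = h - s"
    have h_eq: "h = f + g + \<delta>" and f\<delta>: "f + \<delta> \<in> T1" and g\<delta>: "g + \<delta> \<in> T2"
      using s(1) by (simp_all add: f_def g_def P_def algebra_simps)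
    \<comment> \<open>Otherwise moving one \<delta> from the first part of the decomposition to the
      second would give a \<open>T1\<close>-part of smaller weight.\<close>
    have f_notin: "f \<notin> T1"
    proof
      assume f: "f \<in> T1"
      have "P f"
        using f submonoid_add[OF T2(1) g\<delta> \<delta>(2)] by (simp add: P_def h_eq algebra_simps)
      then have "w s \<le> w f"
        using s(2)[of f] w_nonneg[OF f] s(1) w_nonneg[of s] by (simp add: P_def)
      then show False
        using w\<delta> by (simp add: f_def w_diff)
    qed
    have g_notin: "g \<notin> T2"
    proof
      assume "g \<in> T2"
      then have "(f + \<delta>) + g \<in> ?T" using f\<delta> by blast
      then show False using hT(1) by (simp add: h_eq algebra_simps)
    qed
    \<comment> \<open>If this failed, \<open>f + a\<close> and \<open>g\<close> would meet the
      hypotheses of \<open>notin\<close>, putting \<open>h + a\<close> outside the sum although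
      \<open>h\<close> absorbs \<open>a\<close>.\<close>
    have "f + a \<in> T1" if a: "a \<in> T1 - {0}" for a
    proof (rule ccontr)
      assume "f + a \<notin> T1"
      moreover have "(f + a) + \<delta> \<in> T1"
        using submonoid_add[OF T1(1) f\<delta>, of a] a by (simp add: algebra_simps)
      ultimately have "(f + a) + g + \<delta> \<notin> ?T"
        using notin g\<delta> g_notin by blast
      moreover have "h + a \<in> ?T"
        using hT(2) inT(1)[of a \<delta>] a \<delta> by blast
      moreover have "(f + a) + g + \<delta> = h + a"
        by (simp add: h_eq add_ac)
      ultimately show False by (simp only: not_True_eq_False)
    qed
    \<comment> \<open>The cone condition comes from \<open>pseudo_frobeniusI\<close>; \<delta>
      witnesses \<open>T1 \<noteq> {0}\<close>.\<close>
    then have f_pf: "f \<in> pseudo_frobenius T1"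
      using \<delta> T1 A1 ne(1) f_notin by (intro pseudo_frobeniusI[of T1 A1]) auto
    have "g + a \<in> T2" if a: "a \<in> T2 - {0}" for a
    proof (rule ccontr)
      assume "g + a \<notin> T2"
      moreover have "(g + a) + \<delta> \<in> T2"
        using submonoid_add[OF T2(1) g\<delta>, of a] a by (simp add: algebra_simps)
      ultimately have "f + (g + a) + \<delta> \<notin> ?T"
        using notin f\<delta> f_notin by blast
      moreover have "h + a \<in> ?T"
        using hT(2) inT(2)[of \<delta> a] a \<delta> by blast
      moreover have "f + (g + a) + \<delta> = h + a"
        by (simp add: h_eq add_ac)
      ultimately show False by (simp only: not_True_eq_False)
    qed
    then have "g \<in> pseudo_frobenius T2"
      using \<delta> T2 A2 ne(2) g_notin by (intro pseudo_frobeniusI[of T2 A2]) auto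
    with f_pf h_eq show "h \<in> ?R" by blast
  qed
qed

section \<open>The embedding of natural vectors\<close>

lemma of_nat_vec_add [simp]: "of_nat_vec (x + y) = of_nat_vec x + of_nat_vec y"
  by (simp add: of_nat_vec_def vec_eq_iff)

lemma of_nat_vec_zero [simp]: "of_nat_vec 0 = 0"
  by (simp add: of_nat_vec_def vec_eq_iff)

lemma of_nat_vec_scale [simp]: "of_nat_vec (n *s x) = of_nat n *s of_nat_vec x"
  by (simp add: of_nat_vec_def vec_eq_iff)

lemma of_nat_vec_sum: "of_nat_vec (sum g A) = (\<Sum>a\<in>A. of_nat_vec (g a))"
  by (induction A rule: infinite_finite_induct) auto

lemma of_nat_vec_eq_iff [simp]:
  "(of_nat_vec x :: 'a::semiring_char_0 ^ 'd) = of_nat_vec y \<longleftrightarrow> x = y"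
  by (simp add: of_nat_vec_def vec_eq_iff)

lemma of_nat_vec_image_mem_iff [simp]:
  "(of_nat_vec x :: 'a::semiring_char_0 ^ 'd) \<in> of_nat_vec ` S \<longleftrightarrow> x \<in> S"
  by auto

lemma of_nat_vec_eq_0_iff [simp]:
  "(of_nat_vec x :: 'a::semiring_char_0 ^ 'd) = 0 \<longleftrightarrow> x = 0"
  using of_nat_vec_eq_iff[of x 0] by simp

lemma is_submonoid_of_nat_vec_image: "is_submonoid S \<Longrightarrow> is_submonoid (of_nat_vec ` S)"
  unfolding is_submonoid_def
  by (auto simp flip: of_nat_vec_add) (metis image_eqI of_nat_vec_zero)

section \<open>Minimal generators of affine semigroups\<close>

lemma is_minimal_generating_set_min_gens:
  assumes "is_submonoid S"
  shows "is_minimal_generating_set (min_gens S) S"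
  unfolding min_gens_def by (rule theI'[OF ex1_minimal_generating_set[OF assms]])

lemma affine_semigroup_imp_submonoid: "affine_semigroup S \<Longrightarrow> is_submonoid S"
  by (auto simp: affine_semigroup_def is_submonoid_generated)

lemma submonoid_generated_min_gens:
  "affine_semigroup S \<Longrightarrow> submonoid_generated (min_gens S) = S"
  using is_minimal_generating_set_min_gens affine_semigroup_imp_submonoid
  by (auto simp: is_minimal_generating_set_def)

text \<open>A finite generating set has an inclusion-minimal generating subset, which by uniqueness
  is \<open>min_gens S\<close>.\<close>

lemma finite_min_gens:
  assumes "affine_semigroup S"
  shows "finite (min_gens S)"
proof -
  obtain A where A: "finite A" "S = submonoid_generated A"
    using assms by (auto simp: affine_semigroup_def)
  let ?F = "{B. B \<subseteq> A \<and> submonoid_generated B = S}"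
  have "finite ?F" "?F \<noteq> {}"
    using A by auto
  from finite_has_minimal[OF this]
  obtain B where B: "B \<in> ?F" "\<forall>C\<in>?F. C \<subseteq> B \<longrightarrow> B = C"
    by (rule bexE)
  have "submonoid_generated C \<noteq> S" if "C \<subset> B" for C
  proof
    assume "submonoid_generated C = S"
    then have "C \<in> ?F" using that B(1) by auto
    then show False using B(2) that by auto
  qed
  then have "is_minimal_generating_set B S"
    using B(1) by (simp add: is_minimal_generating_set_def)
  then have "min_gens S = B"
    unfolding min_gens_def
    using ex1_minimal_generating_set[OF affine_semigroup_imp_submonoid[OF assms]]
    by (rule the1_equality[rotated])
  then show ?thesis
    using B(1) A(1) by (auto intro: finite_subset)
qed

section \<open>The cone and multiples lying in the semigroup\<close>

lemma submonoid_generated_eq_sums: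
  fixes A :: "(nat ^ 'd) set"
  assumes "finite A"
  shows "submonoid_generated A = {\<Sum>a\<in>A. m a *s a | m. True}" (is "_ = ?R")
proof
  have "is_submonoid ?R"
    unfolding is_submonoid_def
  proof (intro conjI ballI)
    show "0 \<in> ?R" by (auto intro!: exI[of _ "\<lambda>_. 0"])
  next
    fix x y assume "x \<in> ?R" "y \<in> ?R"
    then obtain m n where "x = (\<Sum>a\<in>A. m a *s a)" "y = (\<Sum>a\<in>A. n a *s a)" by blast
    then have "x + y = (\<Sum>a\<in>A. (m a + n a) *s a)"
      by (simp add: vector_sadd_rdistrib sum.distrib)
    then show "x + y \<in> ?R" by (auto intro!: exI[of _ "\<lambda>a. m a + n a"])
  qed
  moreover have "A \<subseteq> ?R"
  proof
    fix b assume "b \<in> A"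
    then have "(\<Sum>a\<in>A. (if a = b then 1 else 0) *s a) = b"
      using assms by (simp add: if_distrib[of "\<lambda>c. c *s _"] sum.delta vector_smult_lid
          del: One_nat_def cong: if_cong)
    then show "b \<in> ?R"
      by (auto intro!: exI[of _ "\<lambda>a. if a = b then 1 else 0"])
  qed
  ultimately show "submonoid_generated A \<subseteq> ?R"
    by (rule submonoid_generated_minimal[rotated])
next
  have "m a *s a \<in> submonoid_generated A" if "a \<in> A" for m a
    using submonoid_of_nat_scale[OF is_submonoid_generated, of a A "m a"]
      submonoid_generated_superset[of A] that by auto
  then show "?R \<subseteq> submonoid_generated A"
    by (auto intro!: submonoid_sum is_submonoid_generated)
qed

lemma common_denominator:
  fixes c :: "'a \<Rightarrow> rat"
  assumes "finite A" "\<And>a. a \<in> A \<Longrightarrow> 0 \<le> c a"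
  shows "\<exists>N>0. \<exists>m. \<forall>a\<in>A. of_nat N * c a = of_nat (m a)"
  using assms
proof (induction A rule: finite_induct)
  case empty
  then show ?case by auto
next
  case (insert x A)
  then obtain N m where N: "N > 0" "\<forall>a\<in>A. of_nat N * c a = of_nat (m a)" by auto
  obtain p q where pq: "q > 0" "c x = of_int p / of_int q"
    by (cases "c x") (auto simp: Fract_of_int_quotient)
  have "0 \<le> p"
    using insert.prems[of x] pq by (simp add: zero_le_divide_iff)
  then have "of_nat (nat q) = (of_int q :: rat)" "of_nat (nat p) = (of_int p :: rat)"
    using pq(1) by simp_all
  then have cx: "of_nat (nat q) * c x = of_nat (nat p)"
    using pq by simp
  \<comment> \<open>The denominators multiply: old numerators are scaled by \<open>q\<close>, the
    new numerator \<open>p\<close> by \<open>N\<close>.\<close>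
  have *: "of_nat (N * nat q) * c a = of_nat (if a = x then N * nat p else nat q * m a)"
    if "a \<in> insert x A" for a
  proof (cases "a = x")
    case True
    then show ?thesis using cx by (simp add: mult.assoc)
  next
    case False
    then show ?thesis using N that by (simp add: ac_simps)
  qed
  have "N * nat q > 0" using N pq by simp
  then show ?case
    by (intro exI[of _ "N * nat q"] exI[of _ "\<lambda>a. if a = x then N * nat p else nat q * m a"]
        conjI ballI *)
qed

text \<open>Clearing denominators turns a rational combination into a natural one for a multiple of
  \<open>x\<close>; dividing the coefficients by \<open>n\<close> reverses this.\<close>

lemma in_semigroup_cone_iff:
  assumes "affine_semigroup S"
  shows "of_nat_vec x \<in> semigroup_cone S \<longleftrightarrow> (\<exists>n>0. n *s x \<in> S)"
proof -
  let ?A = "min_gens S"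
  have S: "S = {\<Sum>a\<in>?A. m a *s a | m. True}"
    using submonoid_generated_eq_sums[OF finite_min_gens[OF assms]]
      submonoid_generated_min_gens[OF assms] by simp
  show ?thesis
  proof
    assume "of_nat_vec x \<in> semigroup_cone S"
    then obtain c :: "nat ^ 'a \<Rightarrow> rat" where c: "of_nat_vec x = (\<Sum>a\<in>?A. c a *s of_nat_vec a)" "\<forall>a\<in>?A. 0 \<le> c a"
      unfolding semigroup_cone_def by blast
    obtain N m where N: "N > 0" "\<forall>a\<in>?A. of_nat N * c a = of_nat (m a)"
      using common_denominator[OF finite_min_gens[OF assms], of c] c(2) by blast
    have "(of_nat_vec (N *s x) :: rat ^ 'a) = (\<Sum>a\<in>?A. (of_nat N * c a) *s of_nat_vec a)"
      by (simp add: c(1) vec_eq_iff sum_distrib_left mult.assoc)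
    also have "\<dots> = of_nat_vec (\<Sum>a\<in>?A. m a *s a)"
      using N(2) by (simp add: of_nat_vec_sum)
    finally have "N *s x = (\<Sum>a\<in>?A. m a *s a)"
      by (simp only: of_nat_vec_eq_iff)
    then have "N *s x \<in> S"
      by (subst S) blast
    then show "\<exists>n>0. n *s x \<in> S" using N(1) by blast
  next
    assume "\<exists>n>0. n *s x \<in> S"
    then obtain n where n0: "n > 0" "n *s x \<in> S" by blast
    have "n *s x \<in> {\<Sum>a\<in>?A. m a *s a | m. True}"
      using S n0(2) by (rule subst)
    then obtain m where n: "n > 0" "n *s x = (\<Sum>a\<in>?A. m a *s a)"
      using n0(1) by blast
    have "of_nat n *s of_nat_vec x = (\<Sum>a\<in>?A. of_nat (m a) *s (of_nat_vec a :: rat ^ 'a))"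
      using arg_cong[OF n(2), of of_nat_vec] by (simp add: of_nat_vec_sum)
    then have "inverse (of_nat n) *s (of_nat n *s of_nat_vec x) =
        (\<Sum>a\<in>?A. (of_nat (m a) / of_nat n) *s (of_nat_vec a :: rat ^ 'a))"
      by (simp add: vec_eq_iff sum_distrib_left divide_simps)
    then have "of_nat_vec x = (\<Sum>a\<in>?A. (of_nat (m a) / of_nat n) *s (of_nat_vec a :: rat ^ 'a))"
      using n(1) by (simp add: vector_smult_assoc)
    then show "of_nat_vec x \<in> semigroup_cone S"
      unfolding semigroup_cone_def
      by (intro CollectI exI[of _ "\<lambda>a. of_nat (m a) / of_nat n"]) simp
  qed
qed

text \<open>For natural vectors the two definitions agree clause by clause. What remains is that the
  integer version contains no further vectors.\<close>

lemma of_nat_vec_image_PF: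
  assumes "affine_semigroup S"
  shows "of_nat_vec ` PF S = pseudo_frobenius (of_nat_vec ` S)"
proof -
  have mult: "of_nat n *s of_nat_vec x \<in> (of_nat_vec ` S :: (int ^ 'a) set) \<longleftrightarrow> n *s x \<in> S" for n x
    using of_nat_vec_image_mem_iff[of "n *s x" S] by (simp only: of_nat_vec_scale)
  have add: "of_nat_vec x + of_nat_vec y \<in> (of_nat_vec ` S :: (int ^ 'a) set) \<longleftrightarrow> x + y \<in> S" for x y
    using of_nat_vec_image_mem_iff[of "x + y" S] by (simp only: of_nat_vec_add)
  have minus: "of_nat_vec ` S - {0} = (of_nat_vec ` (S - {0}) :: (int ^ 'a) set)"
    by auto
  have PF_iff: "of_nat_vec x \<in> pseudo_frobenius (of_nat_vec ` S) \<longleftrightarrow> x \<in> PF S" for x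
    by (auto simp: pseudo_frobenius_def PF_def gaps_def in_semigroup_cone_iff[OF assms] mult add minus)
  \<comment> \<open>A positive multiple of \<open>x\<close> has nonnegative coordinates, hence so
    does \<open>x\<close>.\<close>
  have "x \<in> range of_nat_vec" if x: "x \<in> pseudo_frobenius (of_nat_vec ` S)" for x
  proof -
    obtain n y where n: "n > 0" "of_nat n *s x = of_nat_vec y"
      using x by (auto simp: pseudo_frobenius_def)
    have "0 \<le> x $ i" for i
    proof -
      have "0 \<le> int n * x $ i"
        using arg_cong[OF n(2), of "\<lambda>v. v $ i"] by (simp add: of_nat_vec_def)
      then show ?thesis using n(1) by (simp add: zero_le_mult_iff)
    qed
    then have "x = of_nat_vec (\<chi> i. nat (x $ i))"
      by (simp add: of_nat_vec_def vec_eq_iff)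
    then show ?thesis by blast
  qed
  then show ?thesis
    using PF_iff by blast
qed

section \<open>Splitting off generators and decomposing sums\<close>

text \<open>The elements that vanish or have a nonzero generator as a summand form a submonoid
  containing \<open>A\<close>, hence exhaust the generated one.\<close>

lemma generator_summand:
  fixes A :: "'a::comm_monoid_add set"
  assumes "x \<in> submonoid_generated A" "x \<noteq> 0"
  shows "\<exists>b\<in>A - {0}. \<exists>t\<in>submonoid_generated A. x = b + t"
proof -
  let ?G = "submonoid_generated A"
  let ?M = "{x \<in> ?G. x = 0 \<or> (\<exists>b\<in>A - {0}. \<exists>t\<in>?G. x = b + t)}"
  have G: "is_submonoid ?G" by (rule is_submonoid_generated)
  have "is_submonoid ?M"
    unfolding is_submonoid_def
  proof (intro conjI ballI)
    show "0 \<in> ?M" using submonoid_zero[OF G] by simp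
  next
    fix x y assume xy: "x \<in> ?M" "y \<in> ?M"
    then have "x + y \<in> ?G" using submonoid_add[OF G] by blast
    moreover have "x + y = 0 \<or> (\<exists>b\<in>A - {0}. \<exists>t\<in>?G. x + y = b + t)"
    proof (cases "x = 0")
      case True
      then show ?thesis using xy by auto
    next
      case False
      then obtain b t where b: "b \<in> A - {0}" "t \<in> ?G" "x = b + t" using xy by blast
      then have "x + y = b + (t + y)" "t + y \<in> ?G"
        using xy submonoid_add[OF G] by (auto simp: add.assoc)
      then show ?thesis using b(1) by blast
    qed
    ultimately show "x + y \<in> ?M" by blast
  qed
  moreover have "A \<subseteq> ?M"
    using submonoid_generated_superset[of A] submonoid_zero[OF G] by force
  ultimately have "?G \<subseteq> ?M"
    by (rule submonoid_generated_minimal[rotated])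
  then show ?thesis using assms by blast
qed

text \<open>Provides the finite set for the pigeonhole argument. Zero is removed because the chosen
  generating set may contain it.\<close>

lemma affine_semigroup_int_generators:
  fixes S :: "(nat ^ 'd) set"
  assumes "affine_semigroup S"
  shows "\<exists>A :: (int ^ 'd) set. finite A \<and> A \<subseteq> of_nat_vec ` S - {0} \<and>
    (\<forall>x \<in> of_nat_vec ` S - {0}. \<exists>b\<in>A. x - b \<in> of_nat_vec ` S)"
proof -
  obtain A where A: "finite A" "S = submonoid_generated A"
    using assms by (auto simp: affine_semigroup_def)
  show ?thesis
  proof (intro exI[of _ "of_nat_vec ` (A - {0})"] conjI ballI)
    show "finite (of_nat_vec ` (A - {0}) :: (int ^ 'd) set)" using A by simp
    show "of_nat_vec ` (A - {0}) \<subseteq> (of_nat_vec ` S - {0} :: (int ^ 'd) set)"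
      using submonoid_generated_superset[of A] A by auto
  next
    fix x :: "int ^ 'd" assume "x \<in> of_nat_vec ` S - {0}"
    then obtain y where y: "x = of_nat_vec y" "y \<in> S" "y \<noteq> 0" by auto
    then obtain b t where "b \<in> A - {0}" "t \<in> S" "y = b + t"
      using generator_summand[of y A] A(2) by blast
    then show "\<exists>b\<in>of_nat_vec ` (A - {0}). x - b \<in> of_nat_vec ` S"
      using y by (auto intro!: bexI[of _ b])
  qed
qed

text \<open>Applied to the partition of the minimal generators, this yields the decomposition of a
  gluing as the sum of its two parts.\<close>

lemma submonoid_generated_Un:
  fixes A B :: "'a::comm_monoid_add set"
  shows "submonoid_generated (A \<union> B) =
    {x + y | x y. x \<in> submonoid_generated A \<and> y \<in> submonoid_generated B}" (is "?G = ?R")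
proof
  note GA = is_submonoid_generated[of A] and GB = is_submonoid_generated[of B]
  have "is_submonoid ?R"
    unfolding is_submonoid_def
  proof (intro conjI ballI)
    show "0 \<in> ?R" using submonoid_zero[OF GA] submonoid_zero[OF GB] by force
  next
    fix u v assume "u \<in> ?R" "v \<in> ?R"
    then obtain x y x' y' where "u = x + y" "v = x' + y'"
      "x \<in> submonoid_generated A" "y \<in> submonoid_generated B"
      "x' \<in> submonoid_generated A" "y' \<in> submonoid_generated B" by blast
    then have "u + v = (x + x') + (y + y')" "x + x' \<in> submonoid_generated A"
      "y + y' \<in> submonoid_generated B"
      using submonoid_add[OF GA] submonoid_add[OF GB] by (auto simp: ac_simps)
    then show "u + v \<in> ?R" by blast
  qed
  moreover have "A \<union> B \<subseteq> ?R"
    using submonoid_zero[OF GA] submonoid_zero[OF GB]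
      submonoid_generated_superset[of A] submonoid_generated_superset[of B] by force
  ultimately show "?G \<subseteq> ?R"
    by (rule submonoid_generated_minimal[rotated])
next
  have "submonoid_generated A \<subseteq> ?G" "submonoid_generated B \<subseteq> ?G"
    using submonoid_generated_superset[of "A \<union> B"]
    by (intro submonoid_generated_minimal is_submonoid_generated; blast)+
  then show "?R \<subseteq> ?G"
    using submonoid_add[OF is_submonoid_generated] by blast
qed

section \<open>Transfer of the gluing formula to affine semigroups\<close>

theorem theorem2p6:
  fixes S S1 S2 :: "(nat ^ 'd) set" and \<delta> :: "nat ^ 'd"
  assumes "affine_semigroup S"
    and "is_gluing S S1 S2 \<delta>"
    and "\<delta> \<noteq> 0"
    and "MPD_semigroup S1" and "MPD_semigroup S2"
  shows "MPD_semigroup S \<and> PF S = {f + g + \<delta> | f g. f \<in> PF S1 \<and> g \<in> PF S2}"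
proof -
  let ?e = "of_nat_vec :: nat ^ 'd \<Rightarrow> int ^ 'd"
  have aff: "affine_semigroup S1" "affine_semigroup S2" and ne: "PF S1 \<noteq> {}" "PF S2 \<noteq> {}"
    using assms(4,5) by (auto simp: MPD_semigroup_def)
  obtain A1 A2 where A12: "A1 \<union> A2 = min_gens S"
    "S1 = submonoid_generated A1" "S2 = submonoid_generated A2"
    using assms(2) by (auto simp: is_gluing_def)
  have \<delta>: "\<delta> \<in> S1" "\<delta> \<in> S2"
    and groups: "spanned_group S1 \<inter> spanned_group S2 = {k *s ?e \<delta> | k. True}"
    using assms(2) by (auto simp: is_gluing_def)
  have S: "S = {x + y | x y. x \<in> S1 \<and> y \<in> S2}"
    using submonoid_generated_min_gens[OF assms(1)] submonoid_generated_Un[of A1 A2]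
    by (simp add: A12)
  have img: "?e ` S = {x + y | x y. x \<in> ?e ` S1 \<and> y \<in> ?e ` S2}"
    unfolding S by (auto simp: image_iff) (metis of_nat_vec_add)+
  \<comment> \<open>A common difference lies in both spanned groups, whose intersection consists of
    the multiples of \<delta>.\<close>
  have glue: "\<exists>k. a - b = k *s ?e \<delta>"
    if "a \<in> ?e ` S1" "b \<in> ?e ` S1" "c \<in> ?e ` S2" "d \<in> ?e ` S2" "a - b = c - d" for a b c d
  proof -
    have "a - b \<in> spanned_group S1" "c - d \<in> spanned_group S2"
      using that(1-4) by (auto simp: spanned_group_def)
    then have "a - b \<in> spanned_group S1 \<inter> spanned_group S2"
      using that(5) by simp
    then show ?thesis unfolding groups by blast
  qed
  obtain B1 where B1: "finite B1" "B1 \<subseteq> ?e ` S1 - {0}"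
    "\<forall>x \<in> ?e ` S1 - {0}. \<exists>b\<in>B1. x - b \<in> ?e ` S1"
    using affine_semigroup_int_generators[OF aff(1)] by blast
  obtain B2 where B2: "finite B2" "B2 \<subseteq> ?e ` S2 - {0}"
    "\<forall>x \<in> ?e ` S2 - {0}. \<exists>b\<in>B2. x - b \<in> ?e ` S2"
    using affine_semigroup_int_generators[OF aff(2)] by blast
  have nonneg: "0 \<le> x $ i" if "x \<in> range ?e" for x i
    using that by (auto simp: of_nat_vec_def)
  note sub = aff[THEN affine_semigroup_imp_submonoid, THEN is_submonoid_of_nat_vec_image]
  have "pseudo_frobenius (?e ` S) =
      {f + g + ?e \<delta> | f g. f \<in> pseudo_frobenius (?e ` S1) \<and> g \<in> pseudo_frobenius (?e ` S2)}"
    unfolding img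
  proof (rule pseudo_frobenius_gluing)
    show "pseudo_frobenius (?e ` S1) \<noteq> {}" "pseudo_frobenius (?e ` S2) \<noteq> {}"
      using ne by (simp_all flip: of_nat_vec_image_PF[OF aff(1)] of_nat_vec_image_PF[OF aff(2)])
    show "finite B1" "B1 \<subseteq> ?e ` S1 - {0}" "finite B2" "B2 \<subseteq> ?e ` S2 - {0}"
      by (fact B1 B2)+
    show "\<exists>b\<in>B1. x - b \<in> ?e ` S1" if "x \<in> ?e ` S1 - {0}" for x
      using B1(3) that by blast
    show "\<exists>b\<in>B2. x - b \<in> ?e ` S2" if "x \<in> ?e ` S2 - {0}" for x
      using B2(3) that by blast
    show "\<exists>k. a - b = k *s ?e \<delta>"
      if "a \<in> ?e ` S1" "b \<in> ?e ` S1" "c \<in> ?e ` S2" "d \<in> ?e ` S2" "a - b = c - d" for a b c d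
      using glue that by blast
  qed (use sub \<delta> assms(3) nonneg in auto)
  then have "?e ` PF S = {f + g + ?e \<delta> | f g. f \<in> ?e ` PF S1 \<and> g \<in> ?e ` PF S2}"
    by (simp add: of_nat_vec_image_PF assms(1) aff)
  also have "\<dots> = {?e f + ?e g + ?e \<delta> | f g. f \<in> PF S1 \<and> g \<in> PF S2}"
    by blast
  also have "\<dots> = {?e (f + g + \<delta>) | f g. f \<in> PF S1 \<and> g \<in> PF S2}"
    by simp
  also have "\<dots> = ?e ` {f + g + \<delta> | f g. f \<in> PF S1 \<and> g \<in> PF S2}"
    by blast
  \<comment> \<open>Both sides are images under the injective embedding, so the identity descends to
    natural vectors.\<close>
  finally have PF: "PF S = {f + g + \<delta> | f g. f \<in> PF S1 \<and> g \<in> PF S2}"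
    by (subst (asm) inj_image_eq_iff) (auto intro: injI)
  moreover have "PF S \<noteq> {}"
    unfolding PF using ne by blast
  ultimately show ?thesis
    using assms(1) by (simp add: MPD_semigroup_def)
qed

end
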